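(* Let $n\ge 1$ be an integer, let $\mathcal{C}_n$ be the coset sum, and let $R$ and $\tilde R$ be univariate refinement masks, each with accuracy number at least one. Then: (a) $\mathcal{C}_n[R]$ is interpolatory if and only if $R$ is interpolatory. (b) Suppose that one of $R$ and $\tilde R$ is interpolatory. Then $\mathcal{C}_n[R]$ and $\mathcal{C}_n[\tilde R]$ are biorthogonal if and only if $R$ and $\tilde R$ are biorthogonal. (c) Suppose that $R$ is interpolatory. Then $\mathcal{C}_n[R]$ and $R$ have the same accuracy number.
   Context: Let $\Gamma=\{0,1\}^n$, $\Gamma'=\{0,1\}^n\setminus\{0\}$, $\mathbb{T}^n=[-\pi,\pi]^n$. For $n=1$ these become $\{0,1\}$, $\{1\}$, $[-\pi,\pi]$. An $n$-dimensional mask is a Laurent trigonometric polynomial, i.e. a finite linear combination of the functions $\omega\mapsto e^{-ik\cdot\omega}$, $k\in\mathbb{Z}^n$ (regarded as a $2\pi$-periodic function on $\mathbb{R}^n$). A refinement mask is a mask $\tau$ with $\tau(0)=1$. "Univariate" means $n=1$. A refinement mask $\tau$ is interpolatory if $\sum_{\gamma\in\pi\Gamma}\tau(\omega+\gamma)=1$ for all $\omega\in\mathbb{T}^n$. Refinement masks $\tau$ and $\tau^{\mathrm d}$ are biorthogonal if $\sum_{\gamma\in\pi\Gamma}\overline{\tau(\omega+\gamma)}\,\tau^{\mathrm d}(\omega+\gamma)=1$ for all $\omega\in\mathbb{T}^n$ (overline is complex conjugation). The accuracy number of a refinement mask $\tau$ is the order of the zeros of $\tau$ at the points of $\pi\Gamma'$: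 the largest integer $m\ge 0$ such that $(D^\mu\tau)(\gamma)=0$ for all $\gamma\in\pi\Gamma'$ and all multi-indices $\mu\in\mathbb{N}_0^n$ with $\mu_1+\cdots+\mu_n\le m-1$. The coset sum $\mathcal{C}_n$ maps a univariate refinement mask $R$ to the $n$-dimensional refinement mask $$\mathcal{C}_n[R](\omega)=\frac{1}{2^{n-1}}\Big(1-2^{n-1}+\sum_{\nu\in\Gamma'}R(\omega\cdot\nu)\Big),\quad \omega\in\mathbb{T}^n,$$ where $\omega\cdot\nu$ is the standard inner product. *)

theory Defs
  imports "HOL-Analysis.Analysis"
begin

text \<open>
  The dimension is \<open>n = CARD('n)\<close>. Univariate masks are the instance \<open>real ^ 1\<close> of the
  general notions. Masks are functions on the whole of \<open>real ^ 'n\<close>; their periodicity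
  follows from the definition.
\<close>

definition Gam :: "(real ^ 'n) set" where
  "Gam = {\<gamma>. \<forall>i. \<gamma> $ i \<in> {0, 1}}"

definition Gam' :: "(real ^ 'n) set" where
  "Gam' = Gam - {0}"

definition torus :: "(real ^ 'n) set" where
  "torus = cbox (\<chi> i. - pi) (\<chi> i. pi)"

definition mask :: "(real ^ 'n \<Rightarrow> complex) \<Rightarrow> bool" where
  "mask \<tau> \<longleftrightarrow> (\<exists>(K :: (int ^ 'n) set) c. finite K \<and>
     \<tau> = (\<lambda>\<omega>. \<Sum>k\<in>K. c k * exp (- (\<i> * of_real (\<Sum>i\<in>UNIV. of_int (k $ i) * \<omega> $ i)))))"

definition refinement_mask :: "(real ^ 'n \<Rightarrow> complex) \<Rightarrow> bool" where
  "refinement_mask \<tau> \<longleftrightarrow> mask \<tau> \<and> \<tau> 0 = 1"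

definition interpolatory :: "(real ^ 'n \<Rightarrow> complex) \<Rightarrow> bool" where
  "interpolatory \<tau> \<longleftrightarrow> (\<forall>\<omega>\<in>torus. (\<Sum>\<gamma>\<in>(*\<^sub>R) pi ` Gam. \<tau> (\<omega> + \<gamma>)) = 1)"

definition biorthogonal :: "(real ^ 'n \<Rightarrow> complex) \<Rightarrow> (real ^ 'n \<Rightarrow> complex) \<Rightarrow> bool" where
  "biorthogonal \<tau> \<tau>d \<longleftrightarrow>
     (\<forall>\<omega>\<in>torus. (\<Sum>\<gamma>\<in>(*\<^sub>R) pi ` Gam. cnj (\<tau> (\<omega> + \<gamma>)) * \<tau>d (\<omega> + \<gamma>)) = 1)"

definition partial_deriv :: "'n \<Rightarrow> (real ^ 'n \<Rightarrow> complex) \<Rightarrow> real ^ 'n \<Rightarrow> complex" where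
  "partial_deriv i f x = vector_derivative (\<lambda>t. f (x + t *\<^sub>R axis i 1)) (at 0)"

text \<open>
  A finite type carries no canonical order, so the partial derivatives making up \<open>D\<^sup>\<mu>\<close> are
  taken along an arbitrary fixed enumeration of the coordinates. Masks are smooth, so for
  them the choice is immaterial.
\<close>

definition coords :: "'n::finite list" where
  "coords = (SOME xs. distinct xs \<and> set xs = UNIV)"

definition multi_deriv :: "('n::finite \<Rightarrow> nat) \<Rightarrow> (real ^ 'n \<Rightarrow> complex) \<Rightarrow> real ^ 'n \<Rightarrow> complex" where
  "multi_deriv \<mu> f = foldr (\<lambda>i. partial_deriv i ^^ \<mu> i) coords f"

text \<open>
  The condition \<open>|\<mu>| \<le> m - 1\<close> (in the integers) is written \<open>|\<mu>| < m\<close>, so that it is vacuous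
  for \<open>m = 0\<close>. The maximum exists for every refinement mask: if all derivatives of a
  trigonometric polynomial vanish at one point, then it is identically zero, which
  contradicts \<open>\<tau> 0 = 1\<close>.
\<close>

definition accuracy_number :: "(real ^ 'n::finite \<Rightarrow> complex) \<Rightarrow> nat" where
  "accuracy_number \<tau> = (GREATEST m. \<forall>\<gamma>\<in>(*\<^sub>R) pi ` Gam'. \<forall>\<mu>.
     (\<Sum>i\<in>UNIV. \<mu> i) < m \<longrightarrow> multi_deriv \<mu> \<tau> \<gamma> = 0)"

definition coset_sum :: "(real ^ 1 \<Rightarrow> complex) \<Rightarrow> real ^ 'n \<Rightarrow> complex" where
  "coset_sum R \<omega> = 1 / 2 ^ (CARD('n) - 1) *
     (1 - 2 ^ (CARD('n) - 1) + (\<Sum>\<nu>\<in>Gam'. R (vec (\<omega> \<bullet> \<nu>))))"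

lemma bij_Gam: "bij_betw (\<lambda>S. \<chi> i. if i \<in> S then 1 else 0) UNIV (Gam :: (real ^ 'n) set)"
  unfolding bij_betw_def
proof
  show "inj (\<lambda>S. (\<chi> i. if i \<in> S then 1 else 0) :: real ^ 'n)"
    by (rule injI) (auto simp: vec_eq_iff split: if_splits)
  show "range (\<lambda>S. (\<chi> i. if i \<in> S then 1 else 0) :: real ^ 'n) = Gam"
  proof (intro equalityI subsetI)
    fix x :: "real ^ 'n" assume "x \<in> Gam"
    then have "x = (\<chi> i. if i \<in> {i. x $ i = 1} then 1 else 0)"
      by (auto simp: Gam_def vec_eq_iff)
    then show "x \<in> range (\<lambda>S. \<chi> i. if i \<in> S then 1 else 0)" by blast
  qed (auto simp: Gam_def)
qed

lemma finite_Gam [simp]: "finite (Gam :: (real ^ 'n) set)"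
  using bij_betw_finite[OF bij_Gam] by simp

lemma card_Gam: "card (Gam :: (real ^ 'n) set) = 2 ^ CARD('n)"
  using bij_betw_same_card[OF bij_Gam] card_Pow[OF finite_class.finite_UNIV[where ?'a = 'n]]
  by (metis Pow_UNIV)

lemma zero_in_Gam [simp]: "0 \<in> Gam"
  by (simp add: Gam_def)

lemma mask_const: "mask (\<lambda>\<omega> :: real ^ 'n. a)"
  unfolding mask_def
  by (rule exI[of _ "{0}"], rule exI[of _ "\<lambda>_. a"]) simp

lemma mask_exp:
  "mask (\<lambda>\<omega> :: real ^ 'n. a * exp (- (\<i> * of_real (\<Sum>i\<in>UNIV. of_int (k $ i) * \<omega> $ i))))"
  unfolding mask_def
  by (rule exI[of _ "{k}"], rule exI[of _ "\<lambda>_. a"]) simp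

lemma mask_add:
  assumes "mask f" "mask g"
  shows "mask (\<lambda>\<omega> :: real ^ 'n. f \<omega> + g \<omega>)"
proof -
  let ?e = "\<lambda>(k :: int ^ 'n) (\<omega> :: real ^ 'n).
    exp (- (\<i> * complex_of_real (\<Sum>i\<in>UNIV. of_int (k $ i) * \<omega> $ i)))"
  obtain K c where K: "finite K" "f = (\<lambda>\<omega>. \<Sum>k\<in>K. c k * ?e k \<omega>)"
    using assms(1) unfolding mask_def by blast
  obtain L d where L: "finite L" "g = (\<lambda>\<omega>. \<Sum>k\<in>L. d k * ?e k \<omega>)"
    using assms(2) unfolding mask_def by blast
  let ?c = "\<lambda>k. (if k \<in> K then c k else 0) + (if k \<in> L then d k else 0)"
  have "f \<omega> + g \<omega> = (\<Sum>k\<in>K \<union> L. ?c k * ?e k \<omega>)" for \<omega>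
  proof -
    have "f \<omega> = (\<Sum>k\<in>K \<union> L. (if k \<in> K then c k else 0) * ?e k \<omega>)"
      unfolding K(2) using K(1) L(1) by (intro sum.mono_neutral_cong_left) auto
    moreover have "g \<omega> = (\<Sum>k\<in>K \<union> L. (if k \<in> L then d k else 0) * ?e k \<omega>)"
      unfolding L(2) using K(1) L(1) by (intro sum.mono_neutral_cong_left) auto
    ultimately show ?thesis
      by (simp add: sum.distrib distrib_right)
  qed
  then show ?thesis
    unfolding mask_def using K(1) L(1) by (intro exI[of _ "K \<union> L"] exI[of _ ?c]) auto
qed

lemma mask_sum:
  assumes "finite A" "\<And>a. a \<in> A \<Longrightarrow> mask (f a)"
  shows "mask (\<lambda>\<omega> :: real ^ 'n. \<Sum>a\<in>A. f a \<omega>)"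
  using assms by (induction A) (auto intro: mask_add mask_const)

lemma mask_cmult:
  assumes "mask f"
  shows "mask (\<lambda>\<omega> :: real ^ 'n. a * f \<omega>)"
proof -
  obtain K c where K: "finite K" "f = (\<lambda>\<omega>. \<Sum>k\<in>K. c k *
      exp (- (\<i> * of_real (\<Sum>i\<in>UNIV. of_int (k $ i) * \<omega> $ i))))"
    using assms unfolding mask_def by blast
  have "mask (\<lambda>\<omega>. \<Sum>k\<in>K. (a * c k) * exp (- (\<i> * of_real (\<Sum>i\<in>UNIV. of_int (k $ i) * \<omega> $ i))))"
    by (intro mask_sum mask_exp K(1))
  then show ?thesis
    unfolding K(2) by (simp only: sum_distrib_left mult.assoc)
qed

lemma mask_dilate:
  fixes \<nu> :: "real ^ 'n"
  assumes "mask R" "\<nu> \<in> Gam"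
  shows "mask (\<lambda>\<omega>. R (vec (\<omega> \<bullet> \<nu>) :: real ^ 1))"
proof -
  obtain K c where K: "finite K" "R = (\<lambda>\<omega>. \<Sum>k\<in>K. c k *
      exp (- (\<i> * of_real (\<Sum>i\<in>UNIV. of_int (k $ i) * \<omega> $ i))))"
    using assms unfolding mask_def by blast
  have [simp]: "of_int \<lfloor>\<nu> $ i\<rfloor> = \<nu> $ i" for i
  proof -
    have "\<nu> $ i \<in> {0, 1}" using assms(2) by (simp add: Gam_def)
    then show ?thesis by auto
  qed
  have "mask (\<lambda>\<omega>. \<Sum>k\<in>K. c k *
      exp (- (\<i> * of_real (\<Sum>i\<in>UNIV. of_int ((\<chi> i. k $ 1 * \<lfloor>\<nu> $ i\<rfloor>) $ i) * \<omega> $ i))))"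
    by (intro mask_sum mask_exp K(1))
  also have "(\<lambda>\<omega>. \<Sum>k\<in>K. c k *
      exp (- (\<i> * of_real (\<Sum>i\<in>UNIV. of_int ((\<chi> i. k $ 1 * \<lfloor>\<nu> $ i\<rfloor>) $ i) * \<omega> $ i))))
      = (\<lambda>\<omega>. R (vec (\<omega> \<bullet> \<nu>)))"
    unfolding K(2) by (simp add: inner_vec_def sum_distrib_left mult_ac flip: of_real_mult)
  finally show ?thesis .
qed

lemma refinement_mask_coset_sum:
  assumes "refinement_mask R"
  shows "refinement_mask (coset_sum R :: real ^ 'n \<Rightarrow> complex)"
proof -
  have R: "mask R" "R 0 = 1"
    using assms by (auto simp: refinement_mask_def)
  have fin: "finite (Gam' :: (real ^ 'n) set)"
    by (simp add: Gam'_def)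
  have "mask (coset_sum R :: real ^ 'n \<Rightarrow> complex)"
    unfolding coset_sum_def[abs_def]
    by (intro mask_cmult mask_add mask_const mask_sum mask_dilate fin R) (simp add: Gam'_def)
  moreover have "(coset_sum R :: real ^ 'n \<Rightarrow> complex) 0 = 1"
  proof -
    have v: "(vec 0 :: real ^ 1) = 0" by (simp add: vec_eq_iff)
    obtain m where m: "CARD('n) = Suc m"
      by (metis Suc_pred zero_less_card_finite)
    have "of_nat (card (Gam' :: (real ^ 'n) set)) = (2 * 2 ^ m - 1 :: complex)"
      by (simp add: Gam'_def card_Gam m of_nat_diff)
    then show ?thesis
      by (simp add: coset_sum_def v R(2) m)
  qed
  ultimately show ?thesis
    by (simp add: refinement_mask_def)
qed

end

theory Submission
  imports Defs
begin

text \<open>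
  Write \<open>r t = R (vec t)\<close>, \<open>N = 2 ^ (n - 1)\<close> and \<open>\<chi>\<^sub>\<nu> (g) = cos (\<pi> (g \<bullet> \<nu>)) = \<plusminus>1\<close> for
  \<open>\<nu>, g \<in> \<Gamma>\<close>. By periodicity \<open>r (x + \<pi> (g \<bullet> \<nu>))\<close> is the mean of \<open>r x\<close> and \<open>r (x + \<pi>)\<close> plus
  \<open>\<chi>\<^sub>\<nu> (g)\<close> times half their difference, so orthogonality of the characters \<open>\<chi>\<^sub>\<nu>\<close> turns the
  left-hand sides of the interpolation and biorthogonality conditions for the coset sums into
  affine functions of \<open>\<Sum>\<nu>\<in>\<Gamma>'. F (\<omega> \<bullet> \<nu>)\<close>, where \<open>F = 1\<close> is the univariate condition. Since
  accuracy gives \<open>F 0 = 1\<close>, restricting to \<open>\<omega> = t e\<^sub>i\<close> recovers \<open>F t = 1\<close>.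

  For the accuracy numbers, \<open>D\<^sup>\<mu>\<close> of the coset sum at \<open>\<pi> g\<close> is a combination of the values
  \<open>r\<^sup>(\<^sup>k\<^sup>) (\<pi> (g \<bullet> \<nu>))\<close> with \<open>k = |\<mu>|\<close>, and \<open>r\<^sup>(\<^sup>k\<^sup>) (0) = - r\<^sup>(\<^sup>k\<^sup>) (\<pi>)\<close> for \<open>k \<ge> 1\<close>
  if \<open>R\<close> is interpolatory.
\<close>

subsection \<open>Characters on the vertices of the cube\<close>

text \<open>For vertices this is the character (-1)^(\<open>g \<bullet> \<nu>\<close>) of the group
  (Z/2)^n. The cosine avoids extracting an integer exponent from a real inner product.\<close>

definition cube_char :: "real ^ 'n \<Rightarrow> real ^ 'n \<Rightarrow> complex" where
  "cube_char \<nu> g = of_real (cos (pi * (g \<bullet> \<nu>)))"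

lemma cube_char_commute: "cube_char \<nu> g = cube_char g \<nu>"
  by (simp add: cube_char_def inner_commute)

lemma cube_char_zero [simp]: "cube_char 0 g = 1"
  by (simp add: cube_char_def)

lemma Gam_inner_Nats:
  assumes "g \<in> Gam" "\<nu> \<in> Gam"
  obtains k :: nat where "g \<bullet> \<nu> = real k"
proof -
  have "g $ i * \<nu> $ i \<in> \<nat>" for i
  proof -
    have "g $ i \<in> {0, 1}" "\<nu> $ i \<in> {0, 1}"
      using assms by (auto simp: Gam_def)
    then show ?thesis by auto
  qed
  then have "(\<Sum>i\<in>A. g $ i * \<nu> $ i) \<in> \<nat>" for A
    by (induction A rule: infinite_finite_induct) auto
  then have "g \<bullet> \<nu> \<in> \<nat>"
    unfolding inner_vec_def by simp
  then show ?thesis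
    using that by (auto elim: Nats_cases)
qed

lemma cube_char_square:
  assumes "g \<in> Gam" "\<nu> \<in> Gam"
  shows "cube_char \<nu> g * cube_char \<nu> g = 1"
proof -
  obtain k :: nat where k: "g \<bullet> \<nu> = real k"
    using Gam_inner_Nats[OF assms] .
  have "cos (pi * real k) = (- 1) ^ k"
    by simp
  then show ?thesis
    by (cases "even k") (simp_all add: cube_char_def k)
qed

text \<open>Flipping the coordinate \<open>i\<close> of \<open>g\<close> is an involution of
  \<open>Gam\<close> that negates the first character and fixes the second, so the sum equals its
  own negative.\<close>

lemma cube_char_sum_eq_zero:
  fixes \<nu> \<nu>' :: "real ^ 'n"
  assumes \<nu>: "\<nu> $ i = 1" and \<nu>': "\<nu>' $ i = 0"
  shows "(\<Sum>g\<in>Gam. cube_char \<nu> g * cube_char \<nu>' g) = 0"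
proof -
  \<comment> \<open>Writing the flip as a translation along \<open>axis i 1\<close> makes inner
    products change by one explicit term.\<close>
  define flip :: "real ^ 'n \<Rightarrow> real ^ 'n" where "flip g = g + (1 - 2 * g $ i) *\<^sub>R axis i 1" for g
  have flip_nth: "flip g $ j = (if j = i then 1 - g $ i else g $ j)" for g j
    by (simp add: flip_def axis_def)
  have invol: "flip (flip g) = g" for g
    by (simp add: vec_eq_iff flip_nth)
  have Gam: "flip g \<in> Gam" if "g \<in> Gam" for g
    using that by (auto simp: Gam_def flip_nth)
  have inner: "flip g \<bullet> v = g \<bullet> v + (1 - 2 * g $ i) * v $ i" for g v
    by (simp add: flip_def inner_add_left inner_axis')
  have sign: "cube_char \<nu> (flip g) * cube_char \<nu>' (flip g) = - (cube_char \<nu> g * cube_char \<nu>' g)"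
    if "g \<in> Gam" for g
  proof -
    have "g $ i = 0 \<or> g $ i = 1"
      using that by (auto simp: Gam_def)
    then show ?thesis
      by (auto simp: cube_char_def inner \<nu> \<nu>' ring_distribs)
  qed
  have "(\<Sum>g\<in>Gam. cube_char \<nu> g * cube_char \<nu>' g) =
      (\<Sum>g\<in>Gam. cube_char \<nu> (flip g) * cube_char \<nu>' (flip g))"
    by (rule sum.reindex_bij_witness[of _ flip flip]) (auto simp: invol Gam)
  also have "\<dots> = - (\<Sum>g\<in>Gam. cube_char \<nu> g * cube_char \<nu>' g)"
    by (simp add: sign sum_negf)
  finally show ?thesis
    by simp
qed

lemma cube_char_orthogonal:
  fixes \<nu> \<nu>' :: "real ^ 'n"
  assumes "\<nu> \<in> Gam" "\<nu>' \<in> Gam"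
  shows "(\<Sum>g\<in>Gam. cube_char \<nu> g * cube_char \<nu>' g) = (if \<nu> = \<nu>' then 2 ^ CARD('n) else 0)"
proof (cases "\<nu> = \<nu>'")
  case True
  then show ?thesis
    using assms by (simp add: cube_char_square card_Gam)
next
  case False
  then obtain i where "\<nu> $ i \<noteq> \<nu>' $ i"
    by (auto simp: vec_eq_iff)
  moreover have "\<nu> $ i \<in> {0, 1}" "\<nu>' $ i \<in> {0, 1}"
    using assms by (auto simp: Gam_def)
  ultimately consider "\<nu> $ i = 1" "\<nu>' $ i = 0" | "\<nu> $ i = 0" "\<nu>' $ i = 1"
    by auto
  then show ?thesis
  proof cases
    case 1
    then show ?thesis
      using False by (simp add: cube_char_sum_eq_zero)
  next
    case 2
    then have "(\<Sum>g\<in>Gam. cube_char \<nu>' g * cube_char \<nu> g) = 0"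
      by (simp add: cube_char_sum_eq_zero)
    then show ?thesis
      using False by (simp add: mult.commute)
  qed
qed

section \<open>Vertex sums and Parseval's identity\<close>

lemma finite_Gam' [simp]: "finite Gam'"
  by (simp add: Gam'_def)

lemma Gam'_imp_Gam: "\<nu> \<in> Gam' \<Longrightarrow> \<nu> \<in> Gam"
  by (simp add: Gam'_def)

lemma sum_Gam_split:
  fixes f :: "real ^ 'n \<Rightarrow> 'a :: comm_monoid_add"
  shows "(\<Sum>\<nu>\<in>Gam. f \<nu>) = f 0 + (\<Sum>\<nu>\<in>Gam'. f \<nu>)"
  unfolding Gam'_def by (rule sum.remove) auto

lemma two_power_CARD: "(2 :: 'a :: comm_semiring_1) ^ CARD('n :: finite) = 2 * 2 ^ (CARD('n) - 1)"
  using power_minus_mult[of "CARD('n)" "2 :: 'a"] by (simp add: mult.commute)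

lemma sum_cube_char:
  fixes \<nu> :: "real ^ 'n"
  assumes "\<nu> \<in> Gam'"
  shows "(\<Sum>g\<in>Gam. cube_char \<nu> g) = 0"
  using cube_char_orthogonal[of \<nu> 0] assms by (auto simp: Gam'_def)

lemma sum_Gam'_const:
  "(\<Sum>\<nu>\<in>(Gam' :: (real ^ 'n) set). a) = (2 * 2 ^ (CARD('n) - 1) - 1) * (a :: complex)"
  using sum_Gam_split[of "\<lambda>_ :: real ^ 'n. a"]
  by (simp add: card_Gam two_power_CARD algebra_simps)

text \<open>Parseval's identity on (Z/2)^n in bilinear form: by orthogonality only the diagonal
  terms survive. The coefficients at the trivial character are kept apart as \<open>A\<close> and
  \<open>B\<close> because the constant in the coset sum enters only there.\<close>

lemma cube_char_parseval:
  fixes a b :: "real ^ 'n \<Rightarrow> complex"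
  shows "(\<Sum>g\<in>Gam. (A + (\<Sum>\<nu>\<in>Gam'. a \<nu> * cube_char \<nu> g)) * (B + (\<Sum>\<nu>\<in>Gam'. b \<nu> * cube_char \<nu> g)))
    = 2 * 2 ^ (CARD('n) - 1) * (A * B + (\<Sum>\<nu>\<in>Gam'. a \<nu> * b \<nu>))"
proof -
  \<comment> \<open>The constants become the coefficients at the vertex \<open>0\<close>, so
    orthogonality over all of \<open>Gam\<close> applies.\<close>
  define a' b' where "a' = a(0 := A)" and "b' = b(0 := B)"
  have a': "A + (\<Sum>\<nu>\<in>Gam'. a \<nu> * cube_char \<nu> g) = (\<Sum>\<nu>\<in>Gam. a' \<nu> * cube_char \<nu> g)" for g
    by (simp add: sum_Gam_split a'_def) (rule sum.cong, auto simp: Gam'_def)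
  have b': "B + (\<Sum>\<nu>\<in>Gam'. b \<nu> * cube_char \<nu> g) = (\<Sum>\<nu>\<in>Gam. b' \<nu> * cube_char \<nu> g)" for g
    by (simp add: sum_Gam_split b'_def) (rule sum.cong, auto simp: Gam'_def)
  have ab: "A * B + (\<Sum>\<nu>\<in>Gam'. a \<nu> * b \<nu>) = (\<Sum>\<nu>\<in>Gam. a' \<nu> * b' \<nu>)"
    by (simp add: sum_Gam_split a'_def b'_def) (rule sum.cong, auto simp: Gam'_def)
  have "(\<Sum>g\<in>(Gam :: (real ^ 'n) set).
      (\<Sum>\<nu>\<in>Gam. a' \<nu> * cube_char \<nu> g) * (\<Sum>\<nu>'\<in>Gam. b' \<nu>' * cube_char \<nu>' g)) =
      (\<Sum>g\<in>Gam. \<Sum>\<nu>\<in>Gam. \<Sum>\<nu>'\<in>Gam. a' \<nu> * b' \<nu>' * (cube_char \<nu> g * cube_char \<nu>' g))"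
    by (simp add: sum_product mult_ac)
  also have "\<dots> = (\<Sum>\<nu>\<in>Gam. \<Sum>g\<in>Gam. \<Sum>\<nu>'\<in>Gam. a' \<nu> * b' \<nu>' * (cube_char \<nu> g * cube_char \<nu>' g))"
    by (rule sum.swap)
  also have "\<dots> = (\<Sum>\<nu>\<in>Gam. \<Sum>\<nu>'\<in>Gam. \<Sum>g\<in>Gam. a' \<nu> * b' \<nu>' * (cube_char \<nu> g * cube_char \<nu>' g))"
    by (intro sum.cong refl sum.swap)
  also have "\<dots> = (\<Sum>\<nu>\<in>Gam. \<Sum>\<nu>'\<in>Gam. a' \<nu> * b' \<nu>' * (if \<nu> = \<nu>' then 2 ^ CARD('n) else 0))"
    by (simp add: cube_char_orthogonal flip: sum_distrib_left)
  also have "\<dots> = 2 ^ CARD('n) * (\<Sum>\<nu>\<in>Gam. a' \<nu> * b' \<nu>)"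
    by (simp add: if_distrib[of "\<lambda>x. _ * x"] sum_distrib_left mult_ac cong: if_cong)
  finally show ?thesis
    by (simp add: a' b' ab two_power_CARD)
qed

lemma axis_in_Gam': "axis i 1 \<in> Gam'"
  by (auto simp: Gam'_def Gam_def axis_def vec_eq_iff)

text \<open>Half of the vertices have \<open>i\<close>-th coordinate 1: the character of
  \<open>axis i 1\<close> is \<open>1 - 2 * \<nu> $ i\<close> and sums to zero.\<close>

lemma sum_Gam_nth:
  "(\<Sum>\<nu>\<in>(Gam :: (real ^ 'n) set). complex_of_real (\<nu> $ i)) = 2 ^ (CARD('n) - 1)"
proof -
  have char: "cube_char (axis i 1) \<nu> = 1 - 2 * complex_of_real (\<nu> $ i)"
    if "\<nu> \<in> Gam" for \<nu> :: "real ^ 'n"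
  proof -
    have "\<nu> $ i = 0 \<or> \<nu> $ i = 1"
      using that by (auto simp: Gam_def)
    then show ?thesis
      by (auto simp: cube_char_def inner_axis)
  qed
  have "0 = (\<Sum>\<nu>\<in>(Gam :: (real ^ 'n) set). 1 - 2 * complex_of_real (\<nu> $ i))"
    using sum_cube_char[OF axis_in_Gam', of i] by (simp add: char)
  then show ?thesis
    by (simp add: sum_subtractf card_Gam two_power_CARD flip: sum_distrib_left)
qed

subsection \<open>Periodic functions on the line\<close>

definition periodic2pi :: "(real \<Rightarrow> complex) \<Rightarrow> bool" where
  "periodic2pi f \<longleftrightarrow> (\<forall>t. f (t + 2 * pi) = f t)"

lemma periodic2pi_int:
  assumes "periodic2pi f"
  shows "f (t + 2 * pi * of_int k) = f t"
proof -
  have step: "f (s + 2 * pi) = f s" for s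
    using assms by (simp add: periodic2pi_def)
  show ?thesis
  proof (induction k rule: int_induct[where k = 0])
    case (step1 i)
    have "f (t + 2 * pi * of_int (i + 1)) = f (t + 2 * pi * of_int i + 2 * pi)"
      by (simp add: algebra_simps)
    then show ?case
      using step1 step by simp
  next
    case (step2 i)
    have "f (t + 2 * pi * of_int i) = f (t + 2 * pi * of_int (i - 1) + 2 * pi)"
      by (simp add: algebra_simps)
    then show ?case
      using step2 step by simp
  qed simp
qed

lemma periodic2pi_reduce:
  assumes "periodic2pi f"
  obtains s where "- pi \<le> s" "s \<le> pi" "f s = f t"
proof -
  \<comment> \<open>The number of whole periods that separate \<open>t\<close> from the interval
    [-pi, pi).\<close>
  define k where "k = \<lfloor>(t + pi) / (2 * pi)\<rfloor>"
  have "of_int k \<le> (t + pi) / (2 * pi)" "(t + pi) / (2 * pi) < of_int k + 1"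
    unfolding k_def by linarith+
  then have "- pi \<le> t - 2 * pi * of_int k" "t - 2 * pi * of_int k \<le> pi"
    by (simp_all add: field_simps)
  moreover have "f (t - 2 * pi * of_int k) = f t"
    using periodic2pi_int[OF assms, of "t - 2 * pi * of_int k" k] by simp
  ultimately show ?thesis
    using that by blast
qed

text \<open>For sums over the two points \<open>t\<close> and \<open>t + pi\<close>: a full period
  moves the second point to \<open>t + 3 * pi\<close>.\<close>

lemma periodic2pi_3pi:
  assumes "periodic2pi f"
  shows "f (t + 3 * pi) = f (t + pi)"
  using periodic2pi_int[OF assms, of "t + pi" 1] by (simp add: algebra_simps)

text \<open>Only the parity of \<open>k\<close> matters, and the cosine is the sign that selects one
  of the two values. Being linear in that sign, the formula turns half-period shifts into
  characters.\<close>

lemma periodic2pi_nat_pi: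
  assumes "periodic2pi f"
  shows "f (x + pi * real k) =
    (f x + f (x + pi)) / 2 + of_real (cos (pi * real k)) * ((f x - f (x + pi)) / 2)"
proof (cases "even k")
  case True
  then obtain l where l: "k = 2 * l" ..
  have "f (x + pi * real k) = f x"
    using periodic2pi_int[OF assms, of x "int l"] by (simp add: l mult_ac)
  moreover have "cos (pi * real k) = 1"
    using True by (simp add: mult.commute[of pi])
  ultimately show ?thesis
    by (simp add: field_simps)
next
  case False
  then obtain l where l: "k = 2 * l + 1"
    by (auto elim: oddE)
  have "f (x + pi * real k) = f (x + pi)"
    using periodic2pi_int[OF assms, of "x + pi" "int l"] by (simp add: l algebra_simps)
  moreover have "cos (pi * real k) = - 1"
    using False by (simp add: mult.commute[of pi])
  ultimately show ?thesis
    by (simp add: field_simps)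
qed

lemma periodic2pi_Gam_shift:
  assumes "periodic2pi f" "g \<in> Gam" "\<nu> \<in> Gam"
  shows "f ((\<omega> + pi *\<^sub>R g) \<bullet> \<nu>) =
    (f (\<omega> \<bullet> \<nu>) + f (\<omega> \<bullet> \<nu> + pi)) / 2 + (f (\<omega> \<bullet> \<nu>) - f (\<omega> \<bullet> \<nu> + pi)) / 2 * cube_char \<nu> g"
proof -
  obtain k :: nat where "g \<bullet> \<nu> = real k"
    using Gam_inner_Nats[OF assms(2,3)] .
  then show ?thesis
    using periodic2pi_nat_pi[OF assms(1), of "\<omega> \<bullet> \<nu>" k]
    by (simp add: cube_char_def inner_add_left)
qed

lemma periodic2pi_torus_1:
  assumes "periodic2pi F"
  shows "(\<forall>\<omega>\<in>(torus :: (real ^ 1) set). F (\<omega> $ 1) = c) \<longleftrightarrow> (\<forall>t. F t = c)"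
proof
  assume *: "\<forall>\<omega>\<in>(torus :: (real ^ 1) set). F (\<omega> $ 1) = c"
  show "\<forall>t. F t = c"
  proof
    fix t
    obtain s where s: "- pi \<le> s" "s \<le> pi" "F s = F t"
      using periodic2pi_reduce[OF assms] .
    have "(vec s :: real ^ 1) \<in> torus"
      using s by (simp add: torus_def mem_box_cart)
    then show "F t = c"
      using * s(3) by fastforce
  qed
qed simp

text \<open>The constant on the right is the number of elements of \<open>Gam'\<close>. For the
  converse, on a coordinate axis the sum is affine in one value of \<open>F\<close>, since every
  other term is \<open>F 0 = 1\<close>.\<close>

lemma periodic2pi_torus_sum:
  assumes "periodic2pi F" and F0: "F 0 = 1"
  shows "(\<forall>\<omega>\<in>(torus :: (real ^ 'n) set).
      (\<Sum>\<nu>\<in>Gam'. F (\<omega> \<bullet> \<nu>)) = 2 * 2 ^ (CARD('n) - 1) - 1) \<longleftrightarrow> (\<forall>t. F t = 1)"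
proof
  assume *: "\<forall>\<omega>\<in>(torus :: (real ^ 'n) set).
      (\<Sum>\<nu>\<in>Gam'. F (\<omega> \<bullet> \<nu>)) = 2 * 2 ^ (CARD('n) - 1) - 1"
  show "\<forall>t. F t = 1"
  proof
    fix t
    obtain s where s: "- pi \<le> s" "s \<le> pi" "F s = F t"
      using periodic2pi_reduce[OF assms(1)] .
    obtain i :: 'n where True by blast
    have "(s *\<^sub>R axis i 1 :: real ^ 'n) \<in> torus"
      using s by (auto simp: torus_def mem_box_cart axis_def)
    then have "(\<Sum>\<nu>\<in>(Gam' :: (real ^ 'n) set). F ((s *\<^sub>R axis i 1) \<bullet> \<nu>)) = 2 * 2 ^ (CARD('n) - 1) - 1"
      using * by blast
    then have "2 * 2 ^ (CARD('n) - 1) = (\<Sum>\<nu>\<in>(Gam :: (real ^ 'n) set). F ((s *\<^sub>R axis i 1) \<bullet> \<nu>))"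
      by (simp add: sum_Gam_split F0)
    also have "\<dots> = (\<Sum>\<nu>\<in>(Gam :: (real ^ 'n) set). 1 + (F s - 1) * of_real (\<nu> $ i))"
    proof (rule sum.cong[OF refl])
      fix \<nu> :: "real ^ 'n" assume "\<nu> \<in> Gam"
      then have "\<nu> $ i = 0 \<or> \<nu> $ i = 1"
        by (auto simp: Gam_def)
      then show "F ((s *\<^sub>R axis i 1) \<bullet> \<nu>) = 1 + (F s - 1) * of_real (\<nu> $ i)"
        by (auto simp: inner_axis' F0)
    qed
    also have "\<dots> = 2 * 2 ^ (CARD('n) - 1) + (F s - 1) * 2 ^ (CARD('n) - 1)"
      by (simp add: sum.distrib card_Gam two_power_CARD sum_Gam_nth flip: sum_distrib_left)
    finally show "F t = 1"
      using s(3) by simp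
  qed
qed (use sum_Gam'_const[where ?'n = 'n and a = 1] in simp)

subsection \<open>Interpolation and biorthogonality\<close>

lemma sum_pi_Gam:
  "(\<Sum>\<gamma>\<in>(*\<^sub>R) pi ` Gam. f \<gamma>) = (\<Sum>g\<in>Gam. f (pi *\<^sub>R g))"
  by (subst sum.reindex) (auto simp: inj_on_def)

lemma Gam_1: "(Gam :: (real ^ 1) set) = {0, 1}"
  by (auto simp: Gam_def vec_eq_iff)

lemma sum_pi_Gam_1:
  fixes \<omega> :: "real ^ 1"
  shows "(\<Sum>\<gamma>\<in>(*\<^sub>R) pi ` Gam. f (\<omega> + \<gamma>)) = f (vec (\<omega> $ 1)) + f (vec (\<omega> $ 1 + pi))"
proof -
  have "\<omega> = vec (\<omega> $ 1)" "\<omega> + pi *\<^sub>R 1 = vec (\<omega> $ 1 + pi)"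
    by (simp_all add: vec_eq_iff)
  then show ?thesis
    by (simp add: sum_pi_Gam Gam_1)
qed

text \<open>Differentiating an exponential only multiplies it by \<open>- \<i> * k\<close>, so all
  derivatives are explicit and keep integer frequencies, hence the period. Later arguments reach the
  mask through the sequence \<open>h\<close>.\<close>

lemma mask_derivatives:
  fixes R :: "real ^ 1 \<Rightarrow> complex"
  assumes "mask R"
  shows "\<exists>h. (\<forall>t. h 0 t = R (vec t)) \<and>
    (\<forall>j t. (h j has_vector_derivative h (Suc j) t) (at t)) \<and> (\<forall>j. periodic2pi (h j))"
proof -
  obtain K c where K: "finite K" "R = (\<lambda>\<omega>. \<Sum>k\<in>K. c k *
      exp (- (\<i> * of_real (\<Sum>i\<in>UNIV. of_int (k $ i) * \<omega> $ i))))"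
    using assms unfolding mask_def by blast
  define h where "h j t = (\<Sum>k\<in>K. c k * (- \<i> * of_int (k $ 1)) ^ j *
      exp (of_real t * (- \<i> * of_int (k $ 1))))" for j :: nat and t :: real
  have "h 0 t = R (vec t)" for t
    by (simp add: h_def K(2) mult_ac)
  moreover have "(h j has_vector_derivative h (Suc j) t) (at t)" for j t
    unfolding h_def
    by (rule has_vector_derivative_eq_rhs, rule has_vector_derivative_sum,
        rule has_vector_derivative_mult_right, rule has_vector_derivative_real_field)
       (auto intro!: derivative_eq_intros simp: mult_ac)
  moreover have "periodic2pi (h j)" for j
  proof -
    have "exp (of_real (t + 2 * pi) * (- \<i> * of_int m)) = exp (of_real t * (- \<i> * of_int m))"
      for t :: real and m :: int
      \<comment> \<open>The exponents differ by \<open>- 2 * pi * \<i> * m\<close>, which is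
        \<open>- m\<close> periods of the complex exponential.\<close>
      unfolding exp_eq by (rule exI[of _ "- m"]) (simp add: algebra_simps)
    then show ?thesis
      unfolding periodic2pi_def h_def by (simp only: simp_thms)
  qed
  ultimately show ?thesis
    by blast
qed

lemma periodic2pi_mask:
  fixes R :: "real ^ 1 \<Rightarrow> complex"
  assumes "mask R"
  shows "periodic2pi (\<lambda>t. R (vec t))"
proof -
  obtain h where h: "\<And>t. h 0 t = R (vec t)"
    "\<And>j t. (h j has_vector_derivative h (Suc j) t) (at t)" "\<And>j. periodic2pi (h j)"
    using mask_derivatives[OF assms] by blast
  show ?thesis
    using h(3)[of 0] by (simp add: periodic2pi_def h(1))
qed

lemma interpolatory_1_iff:
  fixes R :: "real ^ 1 \<Rightarrow> complex"
  assumes "mask R"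
  shows "interpolatory R \<longleftrightarrow> (\<forall>t. R (vec t) + R (vec (t + pi)) = 1)"
proof -
  have "periodic2pi (\<lambda>t. R (vec t) + R (vec (t + pi)))"
    using periodic2pi_mask[OF assms] periodic2pi_3pi[OF periodic2pi_mask[OF assms]]
    by (simp add: periodic2pi_def add_ac)
  from periodic2pi_torus_1[OF this] show ?thesis
    by (simp add: interpolatory_def sum_pi_Gam_1)
qed

lemma biorthogonal_1_iff:
  fixes R Rt :: "real ^ 1 \<Rightarrow> complex"
  assumes "mask R" "mask Rt"
  shows "biorthogonal R Rt \<longleftrightarrow>
    (\<forall>t. cnj (R (vec t)) * Rt (vec t) + cnj (R (vec (t + pi))) * Rt (vec (t + pi)) = 1)"
proof -
  have "periodic2pi (\<lambda>t. cnj (R (vec t)) * Rt (vec t) + cnj (R (vec (t + pi))) * Rt (vec (t + pi)))"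
    using periodic2pi_mask[OF assms(1)] periodic2pi_mask[OF assms(2)]
      periodic2pi_3pi[OF periodic2pi_mask[OF assms(1)]] periodic2pi_3pi[OF periodic2pi_mask[OF assms(2)]]
    by (simp add: periodic2pi_def add_ac)
  from periodic2pi_torus_1[OF this] show ?thesis
    using sum_pi_Gam_1[of "\<lambda>x. cnj (R x) * Rt x"] by (simp add: biorthogonal_def)
qed

text \<open>The two sums are complex conjugates and 1 is real. This lets either mask be the
  interpolatory one.\<close>

lemma biorthogonal_commute: "biorthogonal \<tau> \<tau>d \<longleftrightarrow> biorthogonal \<tau>d \<tau>"
proof -
  have "(\<Sum>\<gamma>\<in>(*\<^sub>R) pi ` Gam. cnj (\<tau>d (\<omega> + \<gamma>)) * \<tau> (\<omega> + \<gamma>)) =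
      cnj (\<Sum>\<gamma>\<in>(*\<^sub>R) pi ` Gam. cnj (\<tau> (\<omega> + \<gamma>)) * \<tau>d (\<omega> + \<gamma>))" for \<omega>
    by (simp add: mult.commute)
  then show ?thesis
    by (simp add: biorthogonal_def complex_cnj_one_iff del: cnj_sum)
qed

text \<open>The character expansion in \<open>g\<close> of the shifted coset sum, in the shape that
  \<open>cube_char_parseval\<close> takes: the first bracket is the coefficient of the trivial
  character.\<close>

lemma coset_sum_shift:
  fixes g \<omega> :: "real ^ 'n"
  assumes "periodic2pi (\<lambda>t. R (vec t))" "g \<in> Gam"
  shows "2 ^ (CARD('n) - 1) * coset_sum R (\<omega> + pi *\<^sub>R g) =
    (1 - 2 ^ (CARD('n) - 1) + (\<Sum>\<nu>\<in>Gam'. (R (vec (\<omega> \<bullet> \<nu>)) + R (vec (\<omega> \<bullet> \<nu> + pi))) / 2)) +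
    (\<Sum>\<nu>\<in>Gam'. (R (vec (\<omega> \<bullet> \<nu>)) - R (vec (\<omega> \<bullet> \<nu> + pi))) / 2 * cube_char \<nu> g)"
proof -
  have "(\<Sum>\<nu>\<in>Gam'. R (vec ((\<omega> + pi *\<^sub>R g) \<bullet> \<nu>))) =
    (\<Sum>\<nu>\<in>Gam'. (R (vec (\<omega> \<bullet> \<nu>)) + R (vec (\<omega> \<bullet> \<nu> + pi))) / 2 +
      (R (vec (\<omega> \<bullet> \<nu>)) - R (vec (\<omega> \<bullet> \<nu> + pi))) / 2 * cube_char \<nu> g)"
    using assms by (intro sum.cong refl periodic2pi_Gam_shift) (auto simp: Gam'_imp_Gam)
  then show ?thesis
    by (simp add: coset_sum_def sum.distrib)
qed

text \<open>Summing over the shifts isolates the trivial coefficient, which is affine in the sum of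
  \<open>Q\<close>. The values of \<open>R\<close> at 0 and \<open>pi\<close> give
  \<open>Q 0 = 1\<close>, as \<open>periodic2pi_torus_sum\<close> requires.\<close>

lemma interpolatory_coset_sum_iff:
  fixes R :: "real ^ 1 \<Rightarrow> complex"
  assumes "mask R" "R 0 = 1" "R (vec pi) = 0"
  shows "interpolatory (coset_sum R :: real ^ 'n \<Rightarrow> complex) \<longleftrightarrow> interpolatory R"
proof -
  define N :: complex where "N = 2 ^ (CARD('n) - 1)"
  define Q where "Q t = R (vec t) + R (vec (t + pi))" for t
  have "N \<noteq> 0"
    by (simp add: N_def)
  note per = periodic2pi_mask[OF assms(1)]
  have Q: "periodic2pi Q" "Q 0 = 1"
    using per periodic2pi_3pi[OF per] assms(2,3) by (simp_all add: periodic2pi_def Q_def add_ac vec_eq_iff)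
  have "(\<Sum>\<gamma>\<in>(*\<^sub>R) pi ` Gam. coset_sum R (\<omega> + \<gamma>)) = 2 * (1 - N) + (\<Sum>\<nu>\<in>Gam'. Q (\<omega> \<bullet> \<nu>))"
    for \<omega> :: "real ^ 'n"
  proof -
    have "N * (\<Sum>\<gamma>\<in>(*\<^sub>R) pi ` Gam. coset_sum R (\<omega> + \<gamma>)) = 2 * N * (1 - N + (\<Sum>\<nu>\<in>Gam'. Q (\<omega> \<bullet> \<nu>) / 2))"
    proof -
      define A where "A = 1 - N + (\<Sum>\<nu>\<in>Gam'. Q (\<omega> \<bullet> \<nu>) / 2)"
      define a where "a \<nu> = (R (vec (\<omega> \<bullet> \<nu>)) - R (vec (\<omega> \<bullet> \<nu> + pi))) / 2" for \<nu>
      \<comment> \<open>The second factor is the constant 1, so Parseval's identity evaluates a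
        plain sum.\<close>
      have "N * coset_sum R (\<omega> + pi *\<^sub>R g) =
          (A + (\<Sum>\<nu>\<in>Gam'. a \<nu> * cube_char \<nu> g)) * (1 + (\<Sum>\<nu>\<in>Gam'. 0 * cube_char \<nu> g))"
        if "g \<in> Gam" for g
        using coset_sum_shift[OF per that] by (simp add: N_def A_def a_def Q_def)
      then have "N * (\<Sum>\<gamma>\<in>(*\<^sub>R) pi ` Gam. coset_sum R (\<omega> + \<gamma>)) = (\<Sum>g\<in>Gam.
          (A + (\<Sum>\<nu>\<in>Gam'. a \<nu> * cube_char \<nu> g)) * (1 + (\<Sum>\<nu>\<in>Gam'. 0 * cube_char \<nu> g)))"
        unfolding sum_pi_Gam sum_distrib_left by (intro sum.cong) auto
      then show ?thesis
        unfolding cube_char_parseval by (simp add: N_def A_def)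
    qed
    then have "N * (\<Sum>\<gamma>\<in>(*\<^sub>R) pi ` Gam. coset_sum R (\<omega> + \<gamma>)) =
        N * (2 * (1 - N) + (\<Sum>\<nu>\<in>Gam'. Q (\<omega> \<bullet> \<nu>)))"
      by (simp add: distrib_left flip: sum_divide_distrib)
    then show ?thesis
      using \<open>N \<noteq> 0\<close> by (simp only: mult_cancel_left) blast
  qed
  moreover have "2 * (1 - N) + s = 1 \<longleftrightarrow> s = 2 * N - 1" for s
    using add_left_cancel[of "2 * (1 - N)" s "2 * N - 1"] by (simp add: right_diff_distrib)
  ultimately have "interpolatory (coset_sum R :: real ^ 'n \<Rightarrow> complex) \<longleftrightarrow>
      (\<forall>\<omega>\<in>(torus :: (real ^ 'n) set). (\<Sum>\<nu>\<in>Gam'. Q (\<omega> \<bullet> \<nu>)) = 2 * 2 ^ (CARD('n) - 1) - 1)"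
    unfolding interpolatory_def N_def[symmetric] by simp
  also have "\<dots> \<longleftrightarrow> interpolatory R"
    using periodic2pi_torus_sum[OF Q] interpolatory_1_iff[OF assms(1)] by (simp add: Q_def)
  finally show ?thesis .
qed

text \<open>Interpolation makes the mean of \<open>R\<close> over two half-period translates equal
  to 1/2, so the trivial coefficient of its coset sum is a constant. The product of trivial
  coefficients is then not a double sum, and everything collapses to one sum of
  \<open>B\<close>.\<close>

lemma biorthogonal_coset_sum_iff:
  fixes R Rt :: "real ^ 1 \<Rightarrow> complex"
  assumes "mask R" "R 0 = 1" "R (vec pi) = 0" and "mask Rt" "Rt 0 = 1" "Rt (vec pi) = 0"
    and "interpolatory R"
  shows "biorthogonal (coset_sum R :: real ^ 'n \<Rightarrow> complex) (coset_sum Rt) \<longleftrightarrow> biorthogonal R Rt"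
proof -
  define N :: complex where "N = 2 ^ (CARD('n) - 1)"
  define B where "B t = cnj (R (vec t)) * Rt (vec t) + cnj (R (vec (t + pi))) * Rt (vec (t + pi))" for t
  have "N \<noteq> 0"
    by (simp add: N_def)
  note per = periodic2pi_mask[OF assms(1)] periodic2pi_mask[OF assms(4)]
  have B: "periodic2pi B" "B 0 = 1"
    using per per[THEN periodic2pi_3pi] assms(2,3,5,6)
    by (simp_all add: periodic2pi_def B_def add_ac vec_eq_iff)
  have R: "R (vec (t + pi)) = 1 - R (vec t)" for t
    using assms(7) unfolding interpolatory_1_iff[OF assms(1)] by (metis add_diff_cancel_left')
  have "N * (\<Sum>\<gamma>\<in>(*\<^sub>R) pi ` Gam. cnj (coset_sum R (\<omega> + \<gamma>)) * coset_sum Rt (\<omega> + \<gamma>)) =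
      1 - N + (\<Sum>\<nu>\<in>Gam'. B (\<omega> \<bullet> \<nu>))" for \<omega> :: "real ^ 'n"
  proof -
    \<comment> \<open>Mean and half-difference of \<open>Rt\<close> over the two translates;
      \<open>a'\<close> below is the half-difference for the conjugate of \<open>R\<close>.\<close>
    define b b' where "b t = (Rt (vec t) + Rt (vec (t + pi))) / 2"
      and "b' t = (Rt (vec t) - Rt (vec (t + pi))) / 2" for t
    define a' where "a' t = (cnj (R (vec t)) - cnj (R (vec (t + pi)))) / 2" for t
    have C: "N * cnj (coset_sum R (\<omega> + pi *\<^sub>R g)) = 1 / 2 + (\<Sum>\<nu>\<in>Gam'. a' (\<omega> \<bullet> \<nu>) * cube_char \<nu> g)"
      if "g \<in> Gam" for g
    proof -
      have "N * cnj (coset_sum R (\<omega> + pi *\<^sub>R g)) = cnj (2 ^ (CARD('n) - 1) * coset_sum R (\<omega> + pi *\<^sub>R g))"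
        by (simp add: N_def)
      \<comment> \<open>Each mean is 1/2 and \<open>Gam'\<close> has \<open>2 * N - 1\<close>
        elements, so the constant is \<open>1 - N + (2 * N - 1) / 2 = 1 / 2\<close>.\<close>
      also have "\<dots> = 1 - N + (\<Sum>\<nu>\<in>(Gam' :: (real ^ 'n) set). 1 / 2) + (\<Sum>\<nu>\<in>Gam'. a' (\<omega> \<bullet> \<nu>) * cube_char \<nu> g)"
        unfolding coset_sum_shift[OF per(1) that]
        by (simp add: N_def a'_def R cube_char_def)
      finally show ?thesis
        unfolding sum_Gam'_const by (simp add: field_simps N_def)
    qed
    have Ct: "N * coset_sum Rt (\<omega> + pi *\<^sub>R g) =
        (1 - N + (\<Sum>\<nu>\<in>Gam'. b (\<omega> \<bullet> \<nu>))) + (\<Sum>\<nu>\<in>Gam'. b' (\<omega> \<bullet> \<nu>) * cube_char \<nu> g)"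
      if "g \<in> Gam" for g
      using coset_sum_shift[OF per(2) that] by (simp add: N_def b_def b'_def)
    \<comment> \<open>The pointwise identity behind the collapse; it uses
      \<open>R (vec (t + pi)) = 1 - R (vec t)\<close>.\<close>
    have "b t + 2 * (a' t * b' t) = B t" for t
      unfolding b_def a'_def b'_def B_def R by (simp add: field_simps)
    then have Bsum: "N * (1 - N + (\<Sum>\<nu>\<in>Gam'. b (\<omega> \<bullet> \<nu>) + 2 * (a' (\<omega> \<bullet> \<nu>) * b' (\<omega> \<bullet> \<nu>)))) =
        N * (1 - N + (\<Sum>\<nu>\<in>Gam'. B (\<omega> \<bullet> \<nu>)))"
      by (simp only:)
    have "N * N * (\<Sum>\<gamma>\<in>(*\<^sub>R) pi ` Gam. cnj (coset_sum R (\<omega> + \<gamma>)) * coset_sum Rt (\<omega> + \<gamma>)) =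
        (\<Sum>g\<in>Gam. (N * cnj (coset_sum R (\<omega> + pi *\<^sub>R g))) * (N * coset_sum Rt (\<omega> + pi *\<^sub>R g)))"
      by (simp add: sum_pi_Gam sum_distrib_left mult_ac)
    also have "\<dots> = (\<Sum>g\<in>Gam. (1 / 2 + (\<Sum>\<nu>\<in>Gam'. a' (\<omega> \<bullet> \<nu>) * cube_char \<nu> g)) *
        ((1 - N + (\<Sum>\<nu>\<in>Gam'. b (\<omega> \<bullet> \<nu>))) + (\<Sum>\<nu>\<in>Gam'. b' (\<omega> \<bullet> \<nu>) * cube_char \<nu> g)))"
      by (intro sum.cong refl) (simp only: C Ct)
    also have "\<dots> = 2 * N * (1 / 2 * (1 - N + (\<Sum>\<nu>\<in>Gam'. b (\<omega> \<bullet> \<nu>))) +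
        (\<Sum>\<nu>\<in>Gam'. a' (\<omega> \<bullet> \<nu>) * b' (\<omega> \<bullet> \<nu>)))"
      unfolding N_def by (rule cube_char_parseval)
    also have "\<dots> = N * (1 - N + (\<Sum>\<nu>\<in>Gam'. b (\<omega> \<bullet> \<nu>) + 2 * (a' (\<omega> \<bullet> \<nu>) * b' (\<omega> \<bullet> \<nu>))))"
      by (simp add: sum.distrib algebra_simps flip: sum_distrib_left)
    also note Bsum
    finally show ?thesis
      using \<open>N \<noteq> 0\<close> by simp
  qed
  moreover have "1 - N + s = N * 1 \<longleftrightarrow> s = 2 * N - 1" for s
    using add_left_cancel[of "1 - N" s "2 * N - 1"] by simp
  ultimately have "N * (\<Sum>\<gamma>\<in>(*\<^sub>R) pi ` Gam. cnj (coset_sum R (\<omega> + \<gamma>)) * coset_sum Rt (\<omega> + \<gamma>)) =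
      N * 1 \<longleftrightarrow>
      (\<Sum>\<nu>\<in>Gam'. B (\<omega> \<bullet> \<nu>)) = 2 * N - 1" for \<omega> :: "real ^ 'n"
    by simp
  then have "biorthogonal (coset_sum R :: real ^ 'n \<Rightarrow> complex) (coset_sum Rt) \<longleftrightarrow>
      (\<forall>\<omega>\<in>(torus :: (real ^ 'n) set). (\<Sum>\<nu>\<in>Gam'. B (\<omega> \<bullet> \<nu>)) = 2 * 2 ^ (CARD('n) - 1) - 1)"
    unfolding biorthogonal_def N_def[symmetric] using \<open>N \<noteq> 0\<close> by simp
  also have "\<dots> \<longleftrightarrow> biorthogonal R Rt"
    using periodic2pi_torus_sum[OF B] biorthogonal_1_iff[OF assms(1,4)] by (simp add: B_def)
  finally show ?thesis .
qed

subsection \<open>Accuracy\<close>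

text \<open>By the chain rule each ridge function contributes a factor \<open>\<nu> $ i\<close> and
  moves one step along \<open>h\<close>. The general coefficients \<open>c\<close> keep the form
  closed under iteration.\<close>

lemma partial_deriv_ridge_sum:
  fixes A :: "(real ^ 'n) set"
  assumes h: "\<And>j t. (h j has_vector_derivative h (Suc j) t) (at t)"
  shows "partial_deriv i (\<lambda>\<omega>. \<Sum>\<nu>\<in>A. c \<nu> * h j (\<omega> \<bullet> \<nu>)) =
    (\<lambda>\<omega>. \<Sum>\<nu>\<in>A. (c \<nu> * of_real (\<nu> $ i)) * h (Suc j) (\<omega> \<bullet> \<nu>))"
proof
  fix x :: "real ^ 'n"
  have "((\<lambda>t. h j ((x + t *\<^sub>R axis i 1) \<bullet> \<nu>)) has_vector_derivative \<nu> $ i *\<^sub>R h (Suc j) (x \<bullet> \<nu>)) (at 0)"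
    for \<nu>
  proof -
    have "((\<lambda>t. x \<bullet> \<nu> + t * \<nu> $ i) has_vector_derivative \<nu> $ i) (at 0)"
      by (auto intro!: derivative_eq_intros)
    from vector_diff_chain_at[OF this, of "h j" "h (Suc j) (x \<bullet> \<nu>)"] show ?thesis
      using h by (simp add: o_def inner_add_left inner_axis')
  qed
  then have "((\<lambda>t. \<Sum>\<nu>\<in>A. c \<nu> * h j ((x + t *\<^sub>R axis i 1) \<bullet> \<nu>)) has_vector_derivative
      (\<Sum>\<nu>\<in>A. c \<nu> * (\<nu> $ i *\<^sub>R h (Suc j) (x \<bullet> \<nu>)))) (at 0)"
    by (intro has_vector_derivative_sum has_vector_derivative_mult_right)
  then show "partial_deriv i (\<lambda>\<omega>. \<Sum>\<nu>\<in>A. c \<nu> * h j (\<omega> \<bullet> \<nu>)) x =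
      (\<Sum>\<nu>\<in>A. (c \<nu> * of_real (\<nu> $ i)) * h (Suc j) (x \<bullet> \<nu>))"
    unfolding partial_deriv_def by (simp add: vector_derivative_at scaleR_conv_of_real mult.assoc)
qed

lemma partial_deriv_funpow_ridge_sum:
  fixes A :: "(real ^ 'n) set"
  assumes h: "\<And>j t. (h j has_vector_derivative h (Suc j) t) (at t)"
  shows "(partial_deriv i ^^ m) (\<lambda>\<omega>. \<Sum>\<nu>\<in>A. c \<nu> * h j (\<omega> \<bullet> \<nu>)) =
    (\<lambda>\<omega>. \<Sum>\<nu>\<in>A. (c \<nu> * of_real (\<nu> $ i ^ m)) * h (m + j) (\<omega> \<bullet> \<nu>))"
proof (induction m)
  case (Suc m)
  have "(partial_deriv i ^^ Suc m) (\<lambda>\<omega>. \<Sum>\<nu>\<in>A. c \<nu> * h j (\<omega> \<bullet> \<nu>)) =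
      partial_deriv i (\<lambda>\<omega>. \<Sum>\<nu>\<in>A. (c \<nu> * of_real (\<nu> $ i ^ m)) * h (m + j) (\<omega> \<bullet> \<nu>))"
    by (simp add: Suc.IH)
  also have "\<dots> = (\<lambda>\<omega>. \<Sum>\<nu>\<in>A. (c \<nu> * of_real (\<nu> $ i ^ m)) * of_real (\<nu> $ i) * h (Suc (m + j)) (\<omega> \<bullet> \<nu>))"
    by (rule partial_deriv_ridge_sum[of h, OF h])
  finally show ?case
    by (simp add: mult_ac)
qed simp

text \<open>Induction over an arbitrary list of coordinates; since \<open>coords\<close> lists each
  coordinate once, its order disappears from the result.\<close>

lemma multi_deriv_ridge_sum:
  fixes A :: "(real ^ 'n) set"
  assumes h: "\<And>j t. (h j has_vector_derivative h (Suc j) t) (at t)"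
  shows "multi_deriv \<mu> (\<lambda>\<omega>. \<Sum>\<nu>\<in>A. c \<nu> * h 0 (\<omega> \<bullet> \<nu>)) =
    (\<lambda>\<omega>. \<Sum>\<nu>\<in>A. (c \<nu> * of_real (\<Prod>i\<in>UNIV. \<nu> $ i ^ \<mu> i)) * h (\<Sum>i\<in>UNIV. \<mu> i) (\<omega> \<bullet> \<nu>))"
proof -
  have "foldr (\<lambda>i. partial_deriv i ^^ \<mu> i) xs (\<lambda>\<omega>. \<Sum>\<nu>\<in>A. c \<nu> * h 0 (\<omega> \<bullet> \<nu>)) =
    (\<lambda>\<omega>. \<Sum>\<nu>\<in>A. (c \<nu> * of_real (\<Prod>i\<leftarrow>xs. \<nu> $ i ^ \<mu> i)) * h (\<Sum>i\<leftarrow>xs. \<mu> i) (\<omega> \<bullet> \<nu>))" for xs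
  proof (induction xs)
    case (Cons i xs)
    show ?case
      by (simp only: foldr.simps o_apply Cons.IH partial_deriv_funpow_ridge_sum[of h, OF h])
        (simp add: mult_ac)
  qed simp
  moreover have coords: "distinct (coords :: 'n list) \<and> set (coords :: 'n list) = UNIV"
    unfolding coords_def by (rule someI_ex) (metis finite_distinct_list finite_class.finite_UNIV)
  moreover have "(\<Prod>i\<in>UNIV. \<nu> $ i ^ \<mu> i) = (\<Prod>i\<leftarrow>coords. \<nu> $ i ^ \<mu> i)" for \<nu> :: "real ^ 'n"
    using coords prod.distinct_set_conv_list[of coords "\<lambda>i. \<nu> $ i ^ \<mu> i"] by simp
  moreover have "(\<Sum>i\<in>UNIV. \<mu> i) = (\<Sum>i\<leftarrow>coords. \<mu> i)"
    using coords sum.distinct_set_conv_list[of coords \<mu>] by simp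
  ultimately show ?thesis
    unfolding multi_deriv_def by (simp only:)
qed

text \<open>Since \<open>R 0 = 1\<close>, the constant in the coset sum is absorbed as the term of
  the vertex \<open>0\<close>, which leaves a pure ridge sum.\<close>

lemma coset_sum_ridge_sum:
  fixes R :: "real ^ 1 \<Rightarrow> complex"
  assumes "R 0 = 1"
  defines "N \<equiv> 2 ^ (CARD('n) - 1)"
  shows "(coset_sum R :: real ^ 'n \<Rightarrow> complex) =
    (\<lambda>\<omega>. \<Sum>\<nu>\<in>Gam. (if \<nu> = 0 then (1 - N) / N else 1 / N) * R (vec (\<omega> \<bullet> \<nu>)))"
proof
  fix \<omega> :: "real ^ 'n"
  have v: "(vec 0 :: real ^ 1) = 0"
    by (simp add: vec_eq_iff)
  have "(\<Sum>\<nu>\<in>Gam'. (if \<nu> = 0 then (1 - N) / N else 1 / N) * R (vec (\<omega> \<bullet> \<nu>))) =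
      (\<Sum>\<nu>\<in>Gam'. 1 / N * R (vec (\<omega> \<bullet> \<nu>)))"
    by (rule sum.cong) (auto simp: Gam'_def)
  then show "coset_sum R \<omega> = (\<Sum>\<nu>\<in>Gam. (if \<nu> = 0 then (1 - N) / N else 1 / N) * R (vec (\<omega> \<bullet> \<nu>)))"
    by (simp add: sum_Gam_split coset_sum_def v assms(1) add_divide_distrib N_def
        flip: sum_divide_distrib)
qed

text \<open>At \<open>\<omega> = 0\<close> every mean and every half-difference is 1/2, and the
  characters over \<open>Gam'\<close> sum to -1, so the terms cancel.\<close>

lemma coset_sum_at_vertex:
  fixes g :: "real ^ 'n"
  assumes "mask R" "R 0 = 1" "R (vec pi) = 0" "g \<in> Gam'"
  shows "coset_sum R (pi *\<^sub>R g) = 0"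
proof -
  have v: "(vec 0 :: real ^ 1) = 0"
    by (simp add: vec_eq_iff)
  have g: "g \<in> Gam"
    using assms(4) by (rule Gam'_imp_Gam)
  have "(\<Sum>\<nu>\<in>Gam'. cube_char \<nu> g) = - 1"
    using sum_cube_char[OF assms(4)] sum_Gam_split[of "cube_char g"]
    by (simp add: cube_char_commute[of _ g] eq_neg_iff_add_eq_0 add.commute)
      (simp add: cube_char_commute[of g 0])
  then have "2 ^ (CARD('n) - 1) * coset_sum R (pi *\<^sub>R g) =
      1 - 2 ^ (CARD('n) - 1) + (\<Sum>\<nu>\<in>(Gam' :: (real ^ 'n) set). 1 / 2) - 1 / 2"
    using coset_sum_shift[OF periodic2pi_mask[OF assms(1)] g, of 0]
    by (simp add: v assms(2,3) flip: sum_divide_distrib)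
  then show ?thesis
    unfolding sum_Gam'_const by (simp add: field_simps)
qed

text \<open>The predicate maximised by \<open>accuracy_number\<close>, named so that equal accuracy
  numbers follow from its equivalence for every \<open>m\<close>.\<close>

definition zero_order_ge :: "(real ^ 'n::finite \<Rightarrow> complex) \<Rightarrow> nat \<Rightarrow> bool" where
  "zero_order_ge \<tau> m \<longleftrightarrow> (\<forall>\<gamma>\<in>(*\<^sub>R) pi ` Gam'. \<forall>\<mu>.
     (\<Sum>i\<in>UNIV. \<mu> i) < m \<longrightarrow> multi_deriv \<mu> \<tau> \<gamma> = 0)"

lemma accuracy_number_eq: "accuracy_number \<tau> = (GREATEST m. zero_order_ge \<tau> m)"
  by (simp add: accuracy_number_def zero_order_ge_def)

lemma Gam'_1: "(Gam' :: (real ^ 1) set) = {1}"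
  by (auto simp: Gam'_def Gam_1)

lemma zero_order_ge_1_iff:
  fixes R :: "real ^ 1 \<Rightarrow> complex"
  assumes h: "\<And>t. h 0 t = R (vec t)" "\<And>j t. (h j has_vector_derivative h (Suc j) t) (at t)"
  shows "zero_order_ge R m \<longleftrightarrow> (\<forall>k<m. h k pi = 0)"
proof -
  have "R = (\<lambda>\<omega>. \<Sum>\<nu>\<in>{1 :: real ^ 1}. 1 * h 0 (\<omega> \<bullet> \<nu>))"
  proof
    fix \<omega> :: "real ^ 1"
    have "vec (\<omega> $ 1) = \<omega>"
      by (simp add: vec_eq_iff)
    then show "R \<omega> = (\<Sum>\<nu>\<in>{1 :: real ^ 1}. 1 * h 0 (\<omega> \<bullet> \<nu>))"
      by (simp add: h(1) inner_vec_def)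
  qed
  then have "multi_deriv \<mu> R = (\<lambda>\<omega>. h (\<mu> 1) (\<omega> $ 1))" for \<mu>
    using multi_deriv_ridge_sum[where h = h and c = "\<lambda>_. 1" and A = "{1 :: real ^ 1}", OF h(2)]
    by (simp add: inner_vec_def)
  then have "zero_order_ge R m \<longleftrightarrow> (\<forall>\<mu> :: 1 \<Rightarrow> nat. \<mu> 1 < m \<longrightarrow> h (\<mu> 1) pi = 0)"
    by (simp add: zero_order_ge_def Gam'_1)
  also have "\<dots> \<longleftrightarrow> (\<forall>k<m. h k pi = 0)"
    by (auto dest: spec[of _ "\<lambda>_. k" for k])
  finally show ?thesis .
qed

text \<open>
  No upper bound on the orders is needed: if order 1 fails then 0 is the only order, so
  \<open>GREATEST\<close> is well defined.
\<close>

lemma zero_at_pi: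
  fixes R :: "real ^ 1 \<Rightarrow> complex"
  assumes "mask R" "accuracy_number R \<ge> 1"
  shows "R (vec pi) = 0"
proof (rule ccontr)
  assume "R (vec pi) \<noteq> 0"
  obtain h where h: "\<And>t. h 0 t = R (vec t)"
    "\<And>j t. (h j has_vector_derivative h (Suc j) t) (at t)" "\<And>j. periodic2pi (h j)"
    using mask_derivatives[OF assms(1)] by blast
  have "zero_order_ge R m \<longleftrightarrow> m = 0" for m
    using \<open>R (vec pi) \<noteq> 0\<close> by (auto simp: zero_order_ge_1_iff[of h, OF h(1,2)] h(1) simp flip: neq0_conv)
  then have "accuracy_number R = 0"
    unfolding accuracy_number_eq by (intro Greatest_equality) auto
  with assms(2) show False
    by simp
qed

text \<open>From \<open>R\<close> to the coset sum, derivatives of positive order vanish at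
  \<open>pi\<close> and, by interpolation, at 0, hence at every point that occurs. Conversely, a
  pure derivative along one axis at \<open>pi *\<^sub>R axis i 1\<close> equals
  \<open>h k pi\<close>.\<close>

lemma zero_order_ge_coset_sum_iff:
  fixes R :: "real ^ 1 \<Rightarrow> complex"
  assumes "mask R" "R 0 = 1" "R (vec pi) = 0" "interpolatory R"
  shows "zero_order_ge (coset_sum R :: real ^ 'n \<Rightarrow> complex) m \<longleftrightarrow> zero_order_ge R m"
proof -
  define N :: complex where "N = 2 ^ (CARD('n) - 1)"
  have "N \<noteq> 0"
    by (simp add: N_def)
  define c :: "real ^ 'n \<Rightarrow> complex" where "c \<nu> = (if \<nu> = 0 then (1 - N) / N else 1 / N)" for \<nu>
  obtain h where h: "\<And>t. h 0 t = R (vec t)"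
    "\<And>j t. (h j has_vector_derivative h (Suc j) t) (at t)" "\<And>j. periodic2pi (h j)"
    using mask_derivatives[OF assms(1)] by blast
  have C: "(coset_sum R :: real ^ 'n \<Rightarrow> complex) = (\<lambda>\<omega>. \<Sum>\<nu>\<in>Gam. c \<nu> * h 0 (\<omega> \<bullet> \<nu>))"
    unfolding c_def N_def h(1) by (rule coset_sum_ridge_sum[of R, OF assms(2)])
  have D: "multi_deriv \<mu> (coset_sum R :: real ^ 'n \<Rightarrow> complex) =
      (\<lambda>\<omega>. \<Sum>\<nu>\<in>Gam. (c \<nu> * of_real (\<Prod>i\<in>UNIV. \<nu> $ i ^ \<mu> i)) * h (\<Sum>i\<in>UNIV. \<mu> i) (\<omega> \<bullet> \<nu>))" for \<mu>
    using multi_deriv_ridge_sum[where h = h and c = c and A = Gam, OF h(2)]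
    by (simp only: C)
  \<comment> \<open>The interpolation condition differentiated \<open>k\<close> times.\<close>
  have anti: "h k t + h k (t + pi) = (if k = 0 then 1 else 0)" for k t
  proof (induction k arbitrary: t)
    case 0
    show ?case
      using assms(1,4) by (simp add: interpolatory_1_iff h(1))
  next
    case (Suc k)
    have shift: "((\<lambda>s. h k (s + pi)) has_vector_derivative h (Suc k) (t + pi)) (at t)"
    proof -
      have "((\<lambda>s. s + pi) has_vector_derivative 1) (at t)"
        by (auto intro!: derivative_eq_intros)
      from vector_diff_chain_at[OF this, of "h k" "h (Suc k) (t + pi)"] show ?thesis
        using h(2) by (simp add: o_def)
    qed
    have "((\<lambda>s. h k s + h k (s + pi)) has_vector_derivative h (Suc k) t + h (Suc k) (t + pi)) (at t)"
      by (rule has_vector_derivative_add[OF h(2) shift])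
    moreover have "((\<lambda>s. h k s + h k (s + pi)) has_vector_derivative 0) (at t)"
      by (simp add: Suc.IH)
    ultimately show ?case
      using vector_derivative_unique_at by fastforce
  qed
  have "zero_order_ge (coset_sum R :: real ^ 'n \<Rightarrow> complex) m" if *: "\<forall>k<m. h k pi = 0"
    unfolding zero_order_ge_def
  proof (intro ballI allI impI, elim imageE)
    fix \<gamma> g :: "real ^ 'n" and \<mu> :: "'n \<Rightarrow> nat"
    assume \<gamma>: "\<gamma> = pi *\<^sub>R g" "g \<in> Gam'" and \<mu>: "(\<Sum>i\<in>UNIV. \<mu> i) < m"
    show "multi_deriv \<mu> (coset_sum R) \<gamma> = 0"
    \<comment> \<open>Order zero is separate: \<open>h 0 0 = 1\<close>, so the sum vanishes by
      cancellation and not term by term.\<close>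
    proof (cases "(\<Sum>i\<in>UNIV. \<mu> i) = 0")
      case True
      then have "\<mu> = (\<lambda>_. 0)"
        by auto
      then have "multi_deriv \<mu> (coset_sum R) = (coset_sum R :: real ^ 'n \<Rightarrow> complex)"
        by (simp add: D) (simp add: C)
      then show ?thesis
        using coset_sum_at_vertex[OF assms(1-3) \<gamma>(2)] \<gamma>(1) by simp
    next
      case False
      define k where "k = (\<Sum>i\<in>UNIV. \<mu> i)"
      have "h k pi = 0"
        using * \<mu> by (simp add: k_def)
      moreover have "h k 0 = 0"
        using anti[of k 0] False \<open>h k pi = 0\<close> by (simp add: k_def)
      ultimately have "h k (\<gamma> \<bullet> \<nu>) = 0" if "\<nu> \<in> Gam" for \<nu>
        using periodic2pi_Gam_shift[OF h(3)[of k] Gam'_imp_Gam[OF \<gamma>(2)] that, of 0]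
        by (simp add: \<gamma>(1))
      then show ?thesis
        by (simp add: D flip: k_def)
    qed
  qed
  moreover have "h k pi = 0" if *: "zero_order_ge (coset_sum R :: real ^ 'n \<Rightarrow> complex) m" "k < m" for k
  proof (cases "k = 0")
    case True
    then show ?thesis
      using assms(3) h(1) by simp
  next
    case False
    obtain i :: 'n where True by blast
    define \<mu> where "\<mu> j = (if j = i then k else 0)" for j
    have \<mu>: "(\<Sum>i\<in>UNIV. \<mu> i) = k" "(\<Prod>i\<in>UNIV. \<nu> $ i ^ \<mu> i) = \<nu> $ i ^ k" for \<nu> :: "real ^ 'n"
      by (simp_all add: \<mu>_def if_distrib[of "\<lambda>n. _ ^ n"] cong: if_cong)
    have "0 = multi_deriv \<mu> (coset_sum R) (pi *\<^sub>R axis i 1 :: real ^ 'n)"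
      using * \<mu>(1) axis_in_Gam' by (auto simp: zero_order_ge_def)
    also have "\<dots> = (\<Sum>\<nu>\<in>Gam. (c \<nu> * of_real (\<nu> $ i ^ k)) * h k (pi * \<nu> $ i))"
      by (simp add: D \<mu> inner_axis')
    \<comment> \<open>As \<open>k > 0\<close>, vertices with \<open>\<nu> $ i = 0\<close> drop out,
      among them \<open>0\<close> with its exceptional coefficient. The remaining \<open>N\<close>
      vertices each contribute \<open>h k pi / N\<close>.\<close>
    also have "\<dots> = (\<Sum>\<nu>\<in>(Gam :: (real ^ 'n) set). 1 / N * h k pi * of_real (\<nu> $ i))"
    proof (rule sum.cong[OF refl])
      fix \<nu> :: "real ^ 'n" assume "\<nu> \<in> Gam"
      then have "\<nu> $ i = 0 \<or> \<nu> $ i = 1"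
        by (auto simp: Gam_def)
      then show "c \<nu> * of_real (\<nu> $ i ^ k) * h k (pi * \<nu> $ i) = 1 / N * h k pi * of_real (\<nu> $ i)"
        using False by (auto simp: c_def)
    qed
    also have "\<dots> = h k pi"
      unfolding sum_distrib_left[symmetric] sum_Gam_nth by (simp add: N_def)
    finally show ?thesis
      by simp
  qed
  ultimately show ?thesis
    using zero_order_ge_1_iff[of h, OF h(1,2)] by blast
qed

theorem theorem1:
  fixes R Rt :: "real ^ 1 \<Rightarrow> complex"
  assumes "refinement_mask R" and "refinement_mask Rt"
    and "accuracy_number R \<ge> 1" and "accuracy_number Rt \<ge> 1"
  shows "(interpolatory (coset_sum R :: real ^ 'n \<Rightarrow> complex) \<longleftrightarrow> interpolatory R) \<and>
    (interpolatory R \<or> interpolatory Rt \<longrightarrow>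
       (biorthogonal (coset_sum R :: real ^ 'n \<Rightarrow> complex) (coset_sum Rt) \<longleftrightarrow> biorthogonal R Rt)) \<and>
    (interpolatory R \<longrightarrow>
       accuracy_number (coset_sum R :: real ^ 'n \<Rightarrow> complex) = accuracy_number R)"
proof (intro conjI impI)
  have R: "mask R" "R 0 = 1" and Rt: "mask Rt" "Rt 0 = 1"
    using assms(1,2) by (simp_all add: refinement_mask_def)
  note R = R zero_at_pi[OF R(1) assms(3)] and Rt = Rt zero_at_pi[OF Rt(1) assms(4)]
  show "interpolatory (coset_sum R :: real ^ 'n \<Rightarrow> complex) \<longleftrightarrow> interpolatory R"
    by (rule interpolatory_coset_sum_iff[OF R])
  show "biorthogonal (coset_sum R :: real ^ 'n \<Rightarrow> complex) (coset_sum Rt) \<longleftrightarrow> biorthogonal R Rt"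
    if "interpolatory R \<or> interpolatory Rt"
    \<comment> \<open>If \<open>Rt\<close> is the interpolatory mask, the roles are exchanged and
      both sides are turned around by symmetry.\<close>
    using that biorthogonal_coset_sum_iff[OF R Rt] biorthogonal_coset_sum_iff[OF Rt R]
      biorthogonal_commute by metis
  show "accuracy_number (coset_sum R :: real ^ 'n \<Rightarrow> complex) = accuracy_number R"
    if "interpolatory R"
    using that by (simp add: accuracy_number_eq zero_order_ge_coset_sum_iff[OF R])
qed

end
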